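(* Let $M=(S,T,I,L)$ be a Kripke structure and $\psi$ an LTL formula in positive normal form. Then $M$ has an initialised infinite path $\pi$ such that $\pi\models\psi$ if and only if there exists $k\in\mathbb{N}$ such that the fixpoint evaluation encoding $[\![M,\psi,k]\!]$ is satisfiable. In particular, if $\pi$ is an initialised infinite path of $M$ with $\pi\models_k\psi$, then $[\![M,\psi,k]\!]$ is satisfiable.
   Context: Kripke structures: $AP$ is a set of atomic propositions; $M=(S,T,I,L)$ has a finite set of states $S$ (symbolically: valuations of finitely many Boolean state variables), a total transition relation $T\subseteq S\times S$, initial states $I\subseteq S$ and labelling $L:S\to 2^{AP}$. An infinite path $\pi=s_0s_1\ldots$ (with $(s_i,s_{i+1})\in T$) is initialised if $s_0\in I$; $\pi^i$ denotes $\pi$ with evaluation position $i$. LTL formulas in positive normal form are built from $p,\neg p$ ($p\in AP$) with $\wedge,\vee,\mathbf{X},\mathbf{U},\mathbf{R}$, with semantics: $\pi^i\models p$ iff $p\in L(s_i)$; $\pi^i\models\neg p$ iff not; $\wedge,\vee$ as usual; $\pi^i\models\mathbf{X}\psi_1$ iff $\pi^{i+1}\models\psi_1$; $\pi^i\models\psi_1\mathbf{U}\psi_2$ iff $\exists j\ge i$ with $\pi^j\models\psi_2$ and $\pi^n\models\psi_1$ for all $i\le n<j$; $\pi^i\models\psi_1\mathbf{R}\psi_2$ iff for all $j\ge i$, $\pi^j\models\psi_2$ or $\pi^n\models\psi_1$ for some $i\le n<j$. $\pi\models\psi$ means $\pi^0\models\psi$. $(k,l)$-loops and bounded semantics: $\pi$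 is a $(k,l)$-loop if $\pi=(s_0\ldots s_{l-1})(s_l\ldots s_k)^\omega$ with $0<l\le k$ and $s_{l-1}=s_k$. $\pi\models_k\psi$ iff (a) $\pi$ is a $(k,l)$-loop for some $0<l\le k$ and $\pi^0\models\psi$, or (b) $\pi^0\models^{nl}_k\psi$, where $\models^{nl}_k$ agrees with $\models$ on $p,\neg p,\wedge,\vee$ and: $\pi^i\models^{nl}_k\mathbf{X}\psi_1$ iff $i<k$ and $\pi^{i+1}\models^{nl}_k\psi_1$; $\pi^i\models^{nl}_k\psi_1\mathbf{U}\psi_2$ iff $\exists i\le j\le k$ with $\pi^j\models^{nl}_k\psi_2$ and $\pi^n\models^{nl}_k\psi_1$ for all $i\le n<j$; $\pi^i\models^{nl}_k\psi_1\mathbf{R}\psi_2$ iff $\exists i\le j\le k$ with $\pi^j\models^{nl}_k\psi_1$ and $\pi^n\models^{nl}_k\psi_2$ for all $i\le n\le j$. Encoding. For bound $k$ take propositional copies $s_0,\dots,s_k$ of the state variables. Model constraints: $[\![M]\!]_k=I(s_0)\wedge\bigwedge_{i=1}^k T(s_{i-1},s_i)$. Loop constraints (fresh variables $l_0,\dots,l_k$, $\mathit{InLoop}_0,\dots,\mathit{InLoop}_k$, $\mathit{LoopExists}$): $l_0\Leftrightarrow\bot$, $\mathit{InLoop}_0\Leftrightarrow\bot$, and for $1\le i\le k$: $l_i\Rightarrow(s_{i-1}=s_k)$, $\mathit{InLoop}_i\Leftrightarrow\mathit{InLoop}_{i-1}\vee l_i$, $\mathit{InLoop}_{i-1}\Rightarrow\neg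 l_i$; and $\mathit{LoopExists}\Leftrightarrow\mathit{InLoop}_k$. Formula translation $[\![\varphi]\!]_i$ ($0\le i\le k$), defined recursively: $[\![p]\!]_i$ is the propositional formula over $s_i$ expressing $p\in L(s_i)$, $[\![\neg p]\!]_i$ its negation, $[\![\psi_1\wedge\psi_2]\!]_i=[\![\psi_1]\!]_i\wedge[\![\psi_2]\!]_i$, $[\![\psi_1\vee\psi_2]\!]_i=[\![\psi_1]\!]_i\vee[\![\psi_2]\!]_i$. For $0\le i<k$: $[\![\mathbf{X}\psi_1]\!]_i=[\![\psi_1]\!]_{i+1}$, $[\![\psi_1\mathbf{U}\psi_2]\!]_i=[\![\psi_2]\!]_i\vee([\![\psi_1]\!]_i\wedge[\![\psi_1\mathbf{U}\psi_2]\!]_{i+1})$, $[\![\psi_1\mathbf{R}\psi_2]\!]_i=[\![\psi_2]\!]_i\wedge([\![\psi_1]\!]_i\vee[\![\psi_1\mathbf{R}\psi_2]\!]_{i+1})$. For $i=k$: $[\![\mathbf{X}\psi_1]\!]_k=\bigvee_{j=1}^k(l_j\wedge[\![\psi_1]\!]_j)$, $[\![\psi_1\mathbf{U}\psi_2]\!]_k=[\![\psi_2]\!]_k\vee([\![\psi_1]\!]_k\wedge\bigvee_{j=1}^k(l_j\wedge\langle\!\langle\psi_1\mathbf{U}\psi_2\rangle\!\rangle_j))$, $[\![\psi_1\mathbf{R}\psi_2]\!]_k=[\![\psi_2]\!]_k\wedge([\![\psi_1]\!]_k\vee\bigvee_{j=1}^k(l_j\wedge\langle\!\langle\psi_1\mathbf{R}\psi_2\rangle\!\rangle_j))$.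 Auxiliary translation for $1\le i<k$: $\langle\!\langle\psi_1\mathbf{U}\psi_2\rangle\!\rangle_i=[\![\psi_2]\!]_i\vee([\![\psi_1]\!]_i\wedge\langle\!\langle\psi_1\mathbf{U}\psi_2\rangle\!\rangle_{i+1})$, $\langle\!\langle\psi_1\mathbf{R}\psi_2\rangle\!\rangle_i=[\![\psi_2]\!]_i\wedge([\![\psi_1]\!]_i\vee\langle\!\langle\psi_1\mathbf{R}\psi_2\rangle\!\rangle_{i+1})$, and $\langle\!\langle\psi_1\mathbf{U}\psi_2\rangle\!\rangle_k=\langle\!\langle\psi_1\mathbf{R}\psi_2\rangle\!\rangle_k=[\![\psi_2]\!]_k$. The fixpoint evaluation encoding is $[\![M,\psi,k]\!]=[\![M]\!]_k\wedge(\text{loop constraints})\wedge[\![\psi]\!]_0$. *)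

theory Defs
  imports Main "HOL-Library.Omega_Words_Fun"
begin

subsection \<open>Kripke structures and paths\<close>

record ('s, 'a) kripke_structure =
  states :: "'s set"
  transitions :: "('s \<times> 's) set"
  initial :: "'s set"
  labels :: "'s \<Rightarrow> 'a set"

definition kripke :: "('s, 'a) kripke_structure \<Rightarrow> bool" where
  "kripke M \<longleftrightarrow>
     finite (states M) \<and>
     transitions M \<subseteq> states M \<times> states M \<and>
     (\<forall>s\<in>states M. \<exists>t. (s, t) \<in> transitions M) \<and>
     initial M \<subseteq> states M"

definition infinite_path :: "('s, 'a) kripke_structure \<Rightarrow> 's word \<Rightarrow> bool" where
  "infinite_path M \<pi> \<longleftrightarrow> (\<forall>i. (\<pi> i, \<pi> (Suc i)) \<in> transitions M)"

definition initialised_path :: "('s, 'a) kripke_structure \<Rightarrow> 's word \<Rightarrow> bool" where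
  "initialised_path M \<pi> \<longleftrightarrow> infinite_path M \<pi> \<and> \<pi> 0 \<in> initial M"


subsection \<open>LTL in positive normal form\<close>

datatype 'a ltl =
    Prop 'a
  | NProp 'a
  | And "'a ltl" "'a ltl"
  | Or "'a ltl" "'a ltl"
  | Next "'a ltl"
  | Until "'a ltl" "'a ltl"
  | Release "'a ltl" "'a ltl"

primrec ltl_at :: "('s, 'a) kripke_structure \<Rightarrow> 's word \<Rightarrow> nat \<Rightarrow> 'a ltl \<Rightarrow> bool" where
  "ltl_at M \<pi> i (Prop p) \<longleftrightarrow> p \<in> labels M (\<pi> i)"
| "ltl_at M \<pi> i (NProp p) \<longleftrightarrow> p \<notin> labels M (\<pi> i)"
| "ltl_at M \<pi> i (And \<psi>1 \<psi>2) \<longleftrightarrow> ltl_at M \<pi> i \<psi>1 \<and> ltl_at M \<pi> i \<psi>2"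
| "ltl_at M \<pi> i (Or \<psi>1 \<psi>2) \<longleftrightarrow> ltl_at M \<pi> i \<psi>1 \<or> ltl_at M \<pi> i \<psi>2"
| "ltl_at M \<pi> i (Next \<psi>1) \<longleftrightarrow> ltl_at M \<pi> (Suc i) \<psi>1"
| "ltl_at M \<pi> i (Until \<psi>1 \<psi>2) \<longleftrightarrow>
     (\<exists>j\<ge>i. ltl_at M \<pi> j \<psi>2 \<and> (\<forall>n. i \<le> n \<and> n < j \<longrightarrow> ltl_at M \<pi> n \<psi>1))"
| "ltl_at M \<pi> i (Release \<psi>1 \<psi>2) \<longleftrightarrow>
     (\<forall>j\<ge>i. ltl_at M \<pi> j \<psi>2 \<or> (\<exists>n. i \<le> n \<and> n < j \<and> ltl_at M \<pi> n \<psi>1))"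

definition ltl_sat :: "('s, 'a) kripke_structure \<Rightarrow> 's word \<Rightarrow> 'a ltl \<Rightarrow> bool" where
  "ltl_sat M \<pi> \<psi> \<longleftrightarrow> ltl_at M \<pi> 0 \<psi>"


subsection \<open>Bounded semantics\<close>

definition kl_loop :: "'s word \<Rightarrow> nat \<Rightarrow> nat \<Rightarrow> bool" where
  "kl_loop \<pi> k l \<longleftrightarrow>
     0 < l \<and> l \<le> k \<and> \<pi> (l - 1) = \<pi> k \<and>
     \<pi> = map \<pi> [0..<l] \<frown> (map \<pi> [l..<Suc k])\<^sup>\<omega>"

primrec ltl_nl_at :: "('s, 'a) kripke_structure \<Rightarrow> nat \<Rightarrow> 's word \<Rightarrow> nat \<Rightarrow> 'a ltl \<Rightarrow> bool" where
  "ltl_nl_at M k \<pi> i (Prop p) \<longleftrightarrow> p \<in> labels M (\<pi> i)"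
| "ltl_nl_at M k \<pi> i (NProp p) \<longleftrightarrow> p \<notin> labels M (\<pi> i)"
| "ltl_nl_at M k \<pi> i (And \<psi>1 \<psi>2) \<longleftrightarrow> ltl_nl_at M k \<pi> i \<psi>1 \<and> ltl_nl_at M k \<pi> i \<psi>2"
| "ltl_nl_at M k \<pi> i (Or \<psi>1 \<psi>2) \<longleftrightarrow> ltl_nl_at M k \<pi> i \<psi>1 \<or> ltl_nl_at M k \<pi> i \<psi>2"
| "ltl_nl_at M k \<pi> i (Next \<psi>1) \<longleftrightarrow> i < k \<and> ltl_nl_at M k \<pi> (Suc i) \<psi>1"
| "ltl_nl_at M k \<pi> i (Until \<psi>1 \<psi>2) \<longleftrightarrow>
     (\<exists>j. i \<le> j \<and> j \<le> k \<and> ltl_nl_at M k \<pi> j \<psi>2 \<and>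
          (\<forall>n. i \<le> n \<and> n < j \<longrightarrow> ltl_nl_at M k \<pi> n \<psi>1))"
| "ltl_nl_at M k \<pi> i (Release \<psi>1 \<psi>2) \<longleftrightarrow>
     (\<exists>j. i \<le> j \<and> j \<le> k \<and> ltl_nl_at M k \<pi> j \<psi>1 \<and>
          (\<forall>n. i \<le> n \<and> n \<le> j \<longrightarrow> ltl_nl_at M k \<pi> n \<psi>2))"

definition bounded_sat :: "('s, 'a) kripke_structure \<Rightarrow> nat \<Rightarrow> 's word \<Rightarrow> 'a ltl \<Rightarrow> bool" where
  "bounded_sat M k \<pi> \<psi> \<longleftrightarrow>
     ((\<exists>l. kl_loop \<pi> k l) \<and> ltl_at M \<pi> 0 \<psi>) \<or> ltl_nl_at M k \<pi> 0 \<psi>"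


subsection \<open>Propositional formulas\<close>

datatype 'x prop_form =
    Top
  | Bot
  | Var 'x
  | Neg "'x prop_form"
  | Conj "'x prop_form" "'x prop_form"
  | Disj "'x prop_form" "'x prop_form"
  | Imp "'x prop_form" "'x prop_form"
  | Iff "'x prop_form" "'x prop_form"

primrec holds :: "('x \<Rightarrow> bool) \<Rightarrow> 'x prop_form \<Rightarrow> bool" where
  "holds \<nu> Top \<longleftrightarrow> True"
| "holds \<nu> Bot \<longleftrightarrow> False"
| "holds \<nu> (Var x) \<longleftrightarrow> \<nu> x"
| "holds \<nu> (Neg \<phi>) \<longleftrightarrow> \<not> holds \<nu> \<phi>"
| "holds \<nu> (Conj \<phi> \<chi>) \<longleftrightarrow> holds \<nu> \<phi> \<and> holds \<nu> \<chi>"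
| "holds \<nu> (Disj \<phi> \<chi>) \<longleftrightarrow> holds \<nu> \<phi> \<or> holds \<nu> \<chi>"
| "holds \<nu> (Imp \<phi> \<chi>) \<longleftrightarrow> (holds \<nu> \<phi> \<longrightarrow> holds \<nu> \<chi>)"
| "holds \<nu> (Iff \<phi> \<chi>) \<longleftrightarrow> (holds \<nu> \<phi> \<longleftrightarrow> holds \<nu> \<chi>)"

definition satisfiable :: "'x prop_form \<Rightarrow> bool" where
  "satisfiable \<phi> \<longleftrightarrow> (\<exists>\<nu>. holds \<nu> \<phi>)"

definition Conjs :: "'x prop_form list \<Rightarrow> 'x prop_form" where
  "Conjs \<phi>s = foldr Conj \<phi>s Top"

definition Disjs :: "'x prop_form list \<Rightarrow> 'x prop_form" where
  "Disjs \<phi>s = foldr Disj \<phi>s Bot"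

lemma holds_Conjs [simp]: "holds \<nu> (Conjs \<phi>s) \<longleftrightarrow> (\<forall>\<phi>\<in>set \<phi>s. holds \<nu> \<phi>)"
  by (induction \<phi>s) (auto simp: Conjs_def)

lemma holds_Disjs [simp]: "holds \<nu> (Disjs \<phi>s) \<longleftrightarrow> (\<exists>\<phi>\<in>set \<phi>s. holds \<nu> \<phi>)"
  by (induction \<phi>s) (auto simp: Disjs_def)

lemma set_Conjs [simp]: "set_prop_form (Conjs \<phi>s) = (\<Union>\<phi>\<in>set \<phi>s. set_prop_form \<phi>)"
  by (induction \<phi>s) (auto simp: Conjs_def)

lemma set_Disjs [simp]: "set_prop_form (Disjs \<phi>s) = (\<Union>\<phi>\<in>set \<phi>s. set_prop_form \<phi>)"
  by (induction \<phi>s) (auto simp: Disjs_def)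


subsection \<open>Symbolic representation of a Kripke structure\<close>

datatype 'v trans_var = Cur 'v | Nxt 'v

record ('v, 'a) symbolic =
  state_vars :: "'v list"
  init_form :: "'v prop_form"
  trans_form :: "'v trans_var prop_form"
  label_form :: "'a \<Rightarrow> 'v prop_form"

text \<open>
  \<open>enc\<close> identifies each state with a valuation of the state variables; the states need not
  exhaust all valuations. The formulas for \<open>I\<close> and \<open>T\<close> are the characteristic
  functions of the sets of encoded initial states and transitions, so they are false on
  valuations that encode no state. The value of \<open>enc s\<close> outside the state variables is
  irrelevant.
\<close>

definition encodes :: "('s \<Rightarrow> 'v \<Rightarrow> bool) \<Rightarrow> 'v list \<Rightarrow> 's \<Rightarrow> ('v \<Rightarrow> bool) \<Rightarrow> bool" where
  "encodes enc vs s u \<longleftrightarrow> (\<forall>v\<in>set vs. u v \<longleftrightarrow> enc s v)"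

definition represents ::
  "('s \<Rightarrow> 'v \<Rightarrow> bool) \<Rightarrow> ('v, 'a) symbolic \<Rightarrow> ('s, 'a) kripke_structure \<Rightarrow> bool" where
  "represents enc E M \<longleftrightarrow>
     set_prop_form (init_form E) \<subseteq> set (state_vars E) \<and>
     set_prop_form (trans_form E) \<subseteq> Cur ` set (state_vars E) \<union> Nxt ` set (state_vars E) \<and>
     (\<forall>p. set_prop_form (label_form E p) \<subseteq> set (state_vars E)) \<and>
     (\<forall>s\<in>states M. \<forall>t\<in>states M. encodes enc (state_vars E) s (enc t) \<longrightarrow> s = t) \<and>
     (\<forall>u. holds u (init_form E) \<longleftrightarrow> (\<exists>s\<in>initial M. encodes enc (state_vars E) s u)) \<and>
     (\<forall>u. holds u (trans_form E) \<longleftrightarrow>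
        (\<exists>(s, t)\<in>transitions M.
           encodes enc (state_vars E) s (\<lambda>v. u (Cur v)) \<and>
           encodes enc (state_vars E) t (\<lambda>v. u (Nxt v)))) \<and>
     (\<forall>p. \<forall>s\<in>states M. holds (enc s) (label_form E p) \<longleftrightarrow> p \<in> labels M s)"

text \<open>Every Kripke structure has such a representation, e.g. the one-hot one.\<close>

lemma ex_represents:
  fixes M :: "('s, 'a) kripke_structure"
  assumes "kripke M"
  shows "\<exists>(enc :: 's \<Rightarrow> 's \<Rightarrow> bool) E. represents enc E M"
proof -
  have fin: "finite (states M)" and TS: "transitions M \<subseteq> states M \<times> states M"
    and IS: "initial M \<subseteq> states M"
    using assms by (auto simp: kripke_def)
  have "finite (transitions M)" using fin TS by (meson finite_SigmaI finite_subset)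
  then obtain ts where ts: "set ts = transitions M" using finite_list by blast
  have "finite (initial M)" using fin IS finite_subset by blast
  then obtain ss where ss: "set ss = initial M" using finite_list by blast
  obtain vs where vs: "set vs = states M" using fin finite_list by blast
  define enc where "enc = (\<lambda>s v :: 's. v = s)"
  define ilit :: "'s \<Rightarrow> 's \<Rightarrow> 's prop_form"
    where "ilit = (\<lambda>s v. if v = s then Var v else Neg (Var v))"
  define lit :: "('s \<Rightarrow> 's trans_var) \<Rightarrow> 's \<Rightarrow> 's \<Rightarrow> 's trans_var prop_form"
    where "lit = (\<lambda>c s v. if v = s then Var (c v) else Neg (Var (c v)))"
  define E :: "('s, 'a) symbolic" where "E =
    \<lparr> state_vars = vs,
      init_form = Disjs (map (\<lambda>s. Conjs (map (ilit s) vs)) ss),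
      trans_form = Disjs (map (\<lambda>(s, t). Conj (Conjs (map (lit Cur s) vs))
                                              (Conjs (map (lit Nxt t) vs))) ts),
      label_form = (\<lambda>p. Disjs (map Var (filter (\<lambda>s. p \<in> labels M s) vs))) \<rparr>"
  have lit: "holds u (lit c s v) \<longleftrightarrow> (u (c v) \<longleftrightarrow> v = s)" "set_prop_form (lit c s v) = {c v}"
    for u c s v by (auto simp: lit_def)
  have ilit: "holds u (ilit s v) \<longleftrightarrow> (u v \<longleftrightarrow> v = s)" "set_prop_form (ilit s v) = {v}"
    for u s v by (auto simp: ilit_def)
  have "represents enc E M"
    unfolding represents_def
  proof (intro conjI allI ballI impI)
    show "set_prop_form (init_form E) \<subseteq> set (state_vars E)"
      by (auto simp: E_def ilit)
    show "set_prop_form (trans_form E) \<subseteq> Cur ` set (state_vars E) \<union> Nxt ` set (state_vars E)"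
      by (auto simp: E_def lit)
    show "set_prop_form (label_form E p) \<subseteq> set (state_vars E)" for p
      by (auto simp: E_def)
    show "s = t" if "s \<in> states M" "t \<in> states M" "encodes enc (state_vars E) s (enc t)" for s t
      using that by (auto simp: E_def encodes_def enc_def vs)
    show "holds u (init_form E) \<longleftrightarrow> (\<exists>s\<in>initial M. encodes enc (state_vars E) s u)" for u
      by (simp add: E_def encodes_def enc_def ss ilit)
    show "holds u (trans_form E) \<longleftrightarrow>
        (\<exists>(s, t)\<in>transitions M. encodes enc (state_vars E) s (\<lambda>v. u (Cur v)) \<and>
           encodes enc (state_vars E) t (\<lambda>v. u (Nxt v)))" for u
      by (simp add: E_def encodes_def enc_def ts lit case_prod_unfold)
    show "holds (enc s) (label_form E p) \<longleftrightarrow> p \<in> labels M s" if "s \<in> states M" for p s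
      using that by (auto simp: E_def enc_def vs)
  qed
  then show ?thesis by blast
qed


subsection \<open>The fixpoint evaluation encoding\<close>

datatype 'v enc_var = StateVar nat 'v | Loop nat | InLoop nat | LoopExists

definition trans_at :: "('v, 'a) symbolic \<Rightarrow> nat \<Rightarrow> nat \<Rightarrow> 'v enc_var prop_form" where
  "trans_at E i j =
     map_prop_form (case_trans_var (StateVar i) (StateVar j)) (trans_form E)"

definition state_eq :: "('v, 'a) symbolic \<Rightarrow> nat \<Rightarrow> nat \<Rightarrow> 'v enc_var prop_form" where
  "state_eq E i j =
     Conjs (map (\<lambda>v. Iff (Var (StateVar i v)) (Var (StateVar j v))) (state_vars E))"

definition model_constraints :: "('v, 'a) symbolic \<Rightarrow> nat \<Rightarrow> 'v enc_var prop_form" where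
  "model_constraints E k =
     Conj (map_prop_form (StateVar 0) (init_form E))
          (Conjs (map (\<lambda>i. trans_at E (i - 1) i) [1..<Suc k]))"

definition loop_constraints :: "('v, 'a) symbolic \<Rightarrow> nat \<Rightarrow> 'v enc_var prop_form" where
  "loop_constraints E k =
     Conjs
      ([Iff (Var (Loop 0)) Bot, Iff (Var (InLoop 0)) Bot] @
       concat (map (\<lambda>i.
         [Imp (Var (Loop i)) (state_eq E (i - 1) k),
          Iff (Var (InLoop i)) (Disj (Var (InLoop (i - 1))) (Var (Loop i))),
          Imp (Var (InLoop (i - 1))) (Neg (Var (Loop i)))]) [1..<Suc k]) @
       [Iff (Var LoopExists) (Var (InLoop k))])"

text \<open>
  \<open>trl E k \<psi> i\<close> is the translation of \<open>\<psi>\<close> at position \<open>i\<close> under the bound \<open>k\<close>;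
  \<open>aux_until\<close> and \<open>aux_release\<close> are the auxiliary translations of the
  formulas \<open>Until \<psi>1 \<psi>2\<close> and \<open>Release \<psi>1 \<psi>2\<close>. They are meant for
  positions \<open>i \<le> k\<close> only, so each \<open>else\<close> branch is the case \<open>i = k\<close>.
\<close>

function (sequential)
  trl :: "('v, 'a) symbolic \<Rightarrow> nat \<Rightarrow> 'a ltl \<Rightarrow> nat \<Rightarrow> 'v enc_var prop_form" and
  aux_until :: "('v, 'a) symbolic \<Rightarrow> nat \<Rightarrow> 'a ltl \<Rightarrow> 'a ltl \<Rightarrow> nat \<Rightarrow> 'v enc_var prop_form" and
  aux_release :: "('v, 'a) symbolic \<Rightarrow> nat \<Rightarrow> 'a ltl \<Rightarrow> 'a ltl \<Rightarrow> nat \<Rightarrow> 'v enc_var prop_form"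
where
  "trl E k (Prop p) i = map_prop_form (StateVar i) (label_form E p)"
| "trl E k (NProp p) i = Neg (map_prop_form (StateVar i) (label_form E p))"
| "trl E k (And \<psi>1 \<psi>2) i = Conj (trl E k \<psi>1 i) (trl E k \<psi>2 i)"
| "trl E k (Or \<psi>1 \<psi>2) i = Disj (trl E k \<psi>1 i) (trl E k \<psi>2 i)"
| "trl E k (Next \<psi>1) i =
     (if i < k then trl E k \<psi>1 (Suc i)
      else Disjs (map (\<lambda>j. Conj (Var (Loop j)) (trl E k \<psi>1 j)) [1..<Suc k]))"
| "trl E k (Until \<psi>1 \<psi>2) i =
     (if i < k
      then Disj (trl E k \<psi>2 i) (Conj (trl E k \<psi>1 i) (trl E k (Until \<psi>1 \<psi>2) (Suc i)))
      else Disj (trl E k \<psi>2 i) (Conj (trl E k \<psi>1 i)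
             (Disjs (map (\<lambda>j. Conj (Var (Loop j)) (aux_until E k \<psi>1 \<psi>2 j)) [1..<Suc k]))))"
| "trl E k (Release \<psi>1 \<psi>2) i =
     (if i < k
      then Conj (trl E k \<psi>2 i) (Disj (trl E k \<psi>1 i) (trl E k (Release \<psi>1 \<psi>2) (Suc i)))
      else Conj (trl E k \<psi>2 i) (Disj (trl E k \<psi>1 i)
             (Disjs (map (\<lambda>j. Conj (Var (Loop j)) (aux_release E k \<psi>1 \<psi>2 j)) [1..<Suc k]))))"
| "aux_until E k \<psi>1 \<psi>2 i =
     (if i < k
      then Disj (trl E k \<psi>2 i) (Conj (trl E k \<psi>1 i) (aux_until E k \<psi>1 \<psi>2 (Suc i)))
      else trl E k \<psi>2 i)"
| "aux_release E k \<psi>1 \<psi>2 i =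
     (if i < k
      then Conj (trl E k \<psi>2 i) (Disj (trl E k \<psi>1 i) (aux_release E k \<psi>1 \<psi>2 (Suc i)))
      else trl E k \<psi>2 i)"
  by pat_completeness auto

termination
  by (relation "inv_image (less_than <*lex*> less_than <*lex*> less_than)
    (\<lambda>x. case x of
       Inl (_, k, \<psi>, i) \<Rightarrow> (size \<psi>, 1, k - i)
     | Inr (Inl (_, k, \<psi>1, \<psi>2, i)) \<Rightarrow> (size (Until \<psi>1 \<psi>2), 0, k - i)
     | Inr (Inr (_, k, \<psi>1, \<psi>2, i)) \<Rightarrow> (size (Release \<psi>1 \<psi>2), 0, k - i))") auto

declare trl.simps [simp del] aux_until.simps [simp del] aux_release.simps [simp del]

definition encoding :: "('v, 'a) symbolic \<Rightarrow> 'a ltl \<Rightarrow> nat \<Rightarrow> 'v enc_var prop_form" where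
  "encoding E \<psi> k = Conj (model_constraints E k) (Conj (loop_constraints E k) (trl E k \<psi> 0))"

end

theory Submission
  imports Defs
begin

text \<open>
  Unwinding the recursion turns the translation of an until or release formula at position \<open>i\<close>
  into a statement about the positions \<open>i, \<dots>, k\<close>, plus a second pass through the loop.
  Hence the translation is sound on every path that repeats itself from \<open>l - 1\<close> on at \<open>k\<close>
  for each selected \<open>l\<close> (vacuously so if no loop is selected). Conversely, a satisfied formula
  stays satisfied in the encoding when two positions \<open>l - 1 < k\<close> of the path agree on the state and
  on the truth of all subformulas, and every eventuality true at \<open>l - 1\<close> is fulfilled before
  \<open>k\<close> is left. A \<open>(k, l)\<close>-loop has such positions by periodicity, an arbitrary path by the
  infinite pigeonhole principle. Since formulas are in positive normal form, only implications
  between the two semantics are needed.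
\<close>

section \<open>Propositional formulas\<close>

lemma holds_map_prop_form: "holds \<nu> (map_prop_form f \<phi>) \<longleftrightarrow> holds (\<nu> \<circ> f) \<phi>"
  by (induction \<phi>) auto

lemma holds_cong:
  assumes "\<And>x. x \<in> set_prop_form \<phi> \<Longrightarrow> \<nu> x \<longleftrightarrow> \<nu>' x"
  shows "holds \<nu> \<phi> \<longleftrightarrow> holds \<nu>' \<phi>"
  using assms by (induction \<phi>) auto

section \<open>Linear temporal logic\<close>

lemma ex_ge_shift: "(\<exists>j\<ge>c. P j) \<longleftrightarrow> (\<exists>m. P (c + m))" for c :: nat
  by (metis le_add1 le_Suc_ex)

lemma all_ge_shift: "(\<forall>j\<ge>c. P j) \<longleftrightarrow> (\<forall>m. P (c + m))" for c :: nat
  using ex_ge_shift[of c "\<lambda>j. \<not> P j"] by blast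

lemma ex_between_shift: "(\<exists>n. c \<le> n \<and> n < c + m \<and> P n) \<longleftrightarrow> (\<exists>n<m. P (c + n))" for c :: nat
  using ex_ge_shift[of c "\<lambda>n. n < c + m \<and> P n"] by simp

lemma all_between_shift:
  "(\<forall>n. c \<le> n \<and> n < c + m \<longrightarrow> P n) \<longleftrightarrow> (\<forall>n<m. P (c + n))" for c :: nat
  using ex_between_shift[of c m "\<lambda>n. \<not> P n"] by blast

text \<open>Counting positions as offsets from \<open>i\<close> makes two evaluation positions
  quantify over the same index, so suffix invariance reduces to rewriting and the one-step unfolding
  to splitting off offset 0.\<close>

lemma until_shift:
  "ltl_at M \<pi> i (Until \<phi>1 \<phi>2) \<longleftrightarrow>
     (\<exists>m. ltl_at M \<pi> (i + m) \<phi>2 \<and> (\<forall>n<m. ltl_at M \<pi> (i + n) \<phi>1))"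
  unfolding ltl_at.simps ex_ge_shift all_between_shift by simp

lemma release_shift:
  "ltl_at M \<pi> i (Release \<phi>1 \<phi>2) \<longleftrightarrow>
     (\<forall>m. ltl_at M \<pi> (i + m) \<phi>2 \<or> (\<exists>n<m. ltl_at M \<pi> (i + n) \<phi>1))"
  unfolding ltl_at.simps all_ge_shift ex_between_shift by simp

text \<open>Evaluation at a position never looks back. As \<open>\<pi>\<close> and
  \<open>\<pi>'\<close> may coincide, this also carries truth from one position of a periodic path
  to another.\<close>

lemma ltl_at_suffix_cong:
  assumes "\<And>n. \<pi> (i + n) = \<pi>' (j + n)"
  shows "ltl_at M \<pi> i \<phi> \<longleftrightarrow> ltl_at M \<pi>' j \<phi>"
  using assms
proof (induction \<phi> arbitrary: i j)
  case (Prop p)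
  then show ?case by (metis add_0_right ltl_at.simps(1))
next
  case (NProp p)
  then show ?case by (metis add_0_right ltl_at.simps(2))
next
  case (Next \<phi>)
  have "\<pi> (Suc i + n) = \<pi>' (Suc j + n)" for n
    using Next.prems[of "Suc n"] by simp
  then show ?case using Next.IH by simp
next
  case (Until \<phi>1 \<phi>2)
  have shift: "\<pi> (i + m + n) = \<pi>' (j + m + n)" for m n
    using Until.prems[of "m + n"] by (simp add: add.assoc)
  have eqs: "ltl_at M \<pi> (i + m) \<phi>1 = ltl_at M \<pi>' (j + m) \<phi>1"
       "ltl_at M \<pi> (i + m) \<phi>2 = ltl_at M \<pi>' (j + m) \<phi>2" for m
    using Until.IH shift by blast+
  show ?case unfolding until_shift by (simp add: eqs)
next
  case (Release \<phi>1 \<phi>2)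
  have shift: "\<pi> (i + m + n) = \<pi>' (j + m + n)" for m n
    using Release.prems[of "m + n"] by (simp add: add.assoc)
  have eqs: "ltl_at M \<pi> (i + m) \<phi>1 = ltl_at M \<pi>' (j + m) \<phi>1"
       "ltl_at M \<pi> (i + m) \<phi>2 = ltl_at M \<pi>' (j + m) \<phi>2" for m
    using Release.IH shift by blast+
  show ?case unfolding release_shift by (simp add: eqs)
qed auto

text \<open>The fixpoint equation that the recursion of \<open>trl\<close> copies; through it the
  truth of an until travels along the path position by position.\<close>

lemma until_step:
  "ltl_at M \<pi> i (Until \<phi>1 \<phi>2) \<longleftrightarrow>
     ltl_at M \<pi> i \<phi>2 \<or> ltl_at M \<pi> i \<phi>1 \<and> ltl_at M \<pi> (Suc i) (Until \<phi>1 \<phi>2)"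
proof -
  have "(\<exists>m. P m) \<longleftrightarrow> P 0 \<or> (\<exists>m. P (Suc m))" for P
    by (metis not0_implies_Suc)
  from this[of "\<lambda>m. ltl_at M \<pi> (i + m) \<phi>2 \<and> (\<forall>n<m. ltl_at M \<pi> (i + n) \<phi>1)"] show ?thesis
    unfolding until_shift by (simp add: All_less_Suc2) blast
qed

lemma release_step:
  "ltl_at M \<pi> i (Release \<phi>1 \<phi>2) \<longleftrightarrow>
     ltl_at M \<pi> i \<phi>2 \<and> (ltl_at M \<pi> i \<phi>1 \<or> ltl_at M \<pi> (Suc i) (Release \<phi>1 \<phi>2))"
proof -
  have "(\<forall>m. P m) \<longleftrightarrow> P 0 \<and> (\<forall>m. P (Suc m))" for P
    by (metis not0_implies_Suc)
  from this[of "\<lambda>m. ltl_at M \<pi> (i + m) \<phi>2 \<or> (\<exists>n<m. ltl_at M \<pi> (i + n) \<phi>1)"] show ?thesis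
    unfolding release_shift by (simp add: Ex_less_Suc2) blast
qed

primrec subformulas :: "'a ltl \<Rightarrow> 'a ltl set" where
  "subformulas (Prop p) = {Prop p}"
| "subformulas (NProp p) = {NProp p}"
| "subformulas (And \<phi>1 \<phi>2) = insert (And \<phi>1 \<phi>2) (subformulas \<phi>1 \<union> subformulas \<phi>2)"
| "subformulas (Or \<phi>1 \<phi>2) = insert (Or \<phi>1 \<phi>2) (subformulas \<phi>1 \<union> subformulas \<phi>2)"
| "subformulas (Next \<phi>) = insert (Next \<phi>) (subformulas \<phi>)"
| "subformulas (Until \<phi>1 \<phi>2) = insert (Until \<phi>1 \<phi>2) (subformulas \<phi>1 \<union> subformulas \<phi>2)"
| "subformulas (Release \<phi>1 \<phi>2) = insert (Release \<phi>1 \<phi>2) (subformulas \<phi>1 \<union> subformulas \<phi>2)"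

lemma finite_subformulas: "finite (subformulas \<phi>)"
  by (induction \<phi>) auto

lemma self_in_subformulas [simp]: "\<phi> \<in> subformulas \<phi>"
  by (cases \<phi>) auto

section \<open>Closed forms of the translation\<close>

text \<open>Both temporal operators and both auxiliary translations are recursions of this shape,
  with invariant \<open>a\<close>, goal \<open>b\<close>, and \<open>c\<close> the value handed over
  when \<open>k\<close> is passed without reaching the goal. Downward induction from
  \<open>k\<close> works because the bounded until without continuation obeys the same
  recursion.\<close>

lemma bounded_until_unfold:
  fixes i k :: nat
  assumes "i \<le> k"
    and "\<And>i. i < k \<Longrightarrow> F i \<longleftrightarrow> b i \<or> a i \<and> F (Suc i)"
    and "F k \<longleftrightarrow> b k \<or> a k \<and> c"
  shows "F i \<longleftrightarrow> (\<exists>j. i \<le> j \<and> j \<le> k \<and> b j \<and> (\<forall>n. i \<le> n \<and> n < j \<longrightarrow> a n)) \<or>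
                (\<forall>n. i \<le> n \<and> n \<le> k \<longrightarrow> a n) \<and> c"
  using assms(1)
proof (induction rule: inc_induct)
  case base
  show ?case using assms(3) le_antisym by fastforce
next
  case (step i)
  let ?U = "\<lambda>i. \<exists>j. i \<le> j \<and> j \<le> k \<and> b j \<and> (\<forall>n. i \<le> n \<and> n < j \<longrightarrow> a n)"
  have "?U i \<longleftrightarrow> b i \<or> a i \<and> ?U (Suc i)" (is "?l \<longleftrightarrow> ?r")
  proof
    assume ?l
    then obtain j where j: "i \<le> j" "j \<le> k" "b j" "\<And>n. i \<le> n \<Longrightarrow> n < j \<Longrightarrow> a n" by blast
    show ?r
    proof (cases "j = i")
      case False
      then have "a i" "Suc i \<le> j" using j by auto
      then show ?thesis using j by (meson Suc_leD)
    qed (use j in simp)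
  next
    assume ?r
    then show ?l
    proof
      assume "b i"
      then show ?l using step(2) by (intro exI[of _ i]) auto
    next
      assume "a i \<and> ?U (Suc i)"
      then obtain j where "Suc i \<le> j" "j \<le> k" "b j" "\<forall>n. Suc i \<le> n \<and> n < j \<longrightarrow> a n" "a i" by blast
      then show ?l
        by (metis Suc_leD Suc_leI le_neq_implies_less)
    qed
  qed
  moreover have "(\<forall>n. i \<le> n \<and> n \<le> k \<longrightarrow> a n) \<longleftrightarrow> a i \<and> (\<forall>n. Suc i \<le> n \<and> n \<le> k \<longrightarrow> a n)"
    using step(2) by (metis Suc_leD Suc_leI le_neq_implies_less less_imp_le order_refl)
  ultimately show ?case
    unfolding assms(2)[OF step(2)] step.IH by blast
qed

locale encoding_valuation =
  fixes \<nu> :: "'v enc_var \<Rightarrow> bool" and E :: "('v, 'a) symbolic" and k :: nat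
begin

abbreviation "trl_holds \<phi> i \<equiv> holds \<nu> (trl E k \<phi> i)"

lemma holds_aux_until:
  assumes "i \<le> k"
  shows "holds \<nu> (aux_until E k \<phi>1 \<phi>2 i) \<longleftrightarrow>
    (\<exists>j. i \<le> j \<and> j \<le> k \<and> trl_holds \<phi>2 j \<and> (\<forall>n. i \<le> n \<and> n < j \<longrightarrow> trl_holds \<phi>1 n))"
proof -
  have "holds \<nu> (aux_until E k \<phi>1 \<phi>2 i) \<longleftrightarrow> trl_holds \<phi>2 i \<or>
      trl_holds \<phi>1 i \<and> holds \<nu> (aux_until E k \<phi>1 \<phi>2 (Suc i))" if "i < k" for i
    using that by (subst aux_until.simps) simp
  \<comment> \<open>The value at \<open>k\<close> is brought into the shape of the recursion with
    continuation \<open>False\<close>: an eventuality missed in this pass is not pursued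
    further.\<close>
  moreover have "holds \<nu> (aux_until E k \<phi>1 \<phi>2 k) \<longleftrightarrow> trl_holds \<phi>2 k \<or> trl_holds \<phi>1 k \<and> False"
    by (subst aux_until.simps) simp
  ultimately show ?thesis
    using bounded_until_unfold[OF assms, of "\<lambda>i. holds \<nu> (aux_until E k \<phi>1 \<phi>2 i)"
      "trl_holds \<phi>2" "trl_holds \<phi>1" False]
    by simp
qed

text \<open>
  The recursion \<open>b \<and> (a \<or> F)\<close> of release is the recursion of until with goal \<open>a \<and> b\<close> and
  invariant \<open>b\<close>.
\<close>

lemma holds_aux_release:
  assumes "i \<le> k"
  shows "holds \<nu> (aux_release E k \<phi>1 \<phi>2 i) \<longleftrightarrow>
    (\<exists>j. i \<le> j \<and> j \<le> k \<and> (trl_holds \<phi>1 j \<and> trl_holds \<phi>2 j) \<and>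
       (\<forall>n. i \<le> n \<and> n < j \<longrightarrow> trl_holds \<phi>2 n)) \<or>
    (\<forall>n. i \<le> n \<and> n \<le> k \<longrightarrow> trl_holds \<phi>2 n)"
proof -
  have "holds \<nu> (aux_release E k \<phi>1 \<phi>2 i) \<longleftrightarrow> (trl_holds \<phi>1 i \<and> trl_holds \<phi>2 i) \<or>
      trl_holds \<phi>2 i \<and> holds \<nu> (aux_release E k \<phi>1 \<phi>2 (Suc i))" if "i < k" for i
    using that by (subst aux_release.simps) auto
  \<comment> \<open>Here the continuation is \<open>True\<close>: a release still pending at the end
    of the pass counts as satisfied, as for a greatest fixpoint.\<close>
  moreover have "holds \<nu> (aux_release E k \<phi>1 \<phi>2 k) \<longleftrightarrow>
      (trl_holds \<phi>1 k \<and> trl_holds \<phi>2 k) \<or> trl_holds \<phi>2 k \<and> True"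
    by (subst aux_release.simps) auto
  ultimately show ?thesis
    using bounded_until_unfold[OF assms, of "\<lambda>i. holds \<nu> (aux_release E k \<phi>1 \<phi>2 i)"
      "\<lambda>i. trl_holds \<phi>1 i \<and> trl_holds \<phi>2 i" "trl_holds \<phi>2" True]
    by simp
qed

text \<open>The continuation after \<open>k\<close> is a second pass from a selected
  \<open>l\<close>. If no loop is selected it is false, which leaves the bounded until.\<close>

lemma trl_holds_until:
  assumes "i \<le> k"
  shows "trl_holds (Until \<phi>1 \<phi>2) i \<longleftrightarrow>
    (\<exists>j. i \<le> j \<and> j \<le> k \<and> trl_holds \<phi>2 j \<and> (\<forall>n. i \<le> n \<and> n < j \<longrightarrow> trl_holds \<phi>1 n)) \<or>
    (\<forall>n. i \<le> n \<and> n \<le> k \<longrightarrow> trl_holds \<phi>1 n) \<and>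
    (\<exists>l\<in>{1..k}. \<nu> (Loop l) \<and> holds \<nu> (aux_until E k \<phi>1 \<phi>2 l))"
proof -
  have "trl_holds (Until \<phi>1 \<phi>2) i \<longleftrightarrow> trl_holds \<phi>2 i \<or>
      trl_holds \<phi>1 i \<and> trl_holds (Until \<phi>1 \<phi>2) (Suc i)" if "i < k" for i
    using that by (subst trl.simps) simp
  moreover have "trl_holds (Until \<phi>1 \<phi>2) k \<longleftrightarrow> trl_holds \<phi>2 k \<or> trl_holds \<phi>1 k \<and>
      (\<exists>l\<in>{1..k}. \<nu> (Loop l) \<and> holds \<nu> (aux_until E k \<phi>1 \<phi>2 l))"
    by (subst trl.simps) (simp add: atLeastLessThanSuc_atLeastAtMost del: upt_Suc)
  ultimately show ?thesis
    by (rule bounded_until_unfold[OF assms])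
qed

lemma trl_holds_release:
  assumes "i \<le> k"
  shows "trl_holds (Release \<phi>1 \<phi>2) i \<longleftrightarrow>
    (\<exists>j. i \<le> j \<and> j \<le> k \<and> (trl_holds \<phi>1 j \<and> trl_holds \<phi>2 j) \<and>
       (\<forall>n. i \<le> n \<and> n < j \<longrightarrow> trl_holds \<phi>2 n)) \<or>
    (\<forall>n. i \<le> n \<and> n \<le> k \<longrightarrow> trl_holds \<phi>2 n) \<and>
    (\<exists>l\<in>{1..k}. \<nu> (Loop l) \<and> holds \<nu> (aux_release E k \<phi>1 \<phi>2 l))"
proof -
  have "trl_holds (Release \<phi>1 \<phi>2) i \<longleftrightarrow> (trl_holds \<phi>1 i \<and> trl_holds \<phi>2 i) \<or>
      trl_holds \<phi>2 i \<and> trl_holds (Release \<phi>1 \<phi>2) (Suc i)" if "i < k" for i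
    using that by (subst trl.simps) auto
  moreover have "trl_holds (Release \<phi>1 \<phi>2) k \<longleftrightarrow> (trl_holds \<phi>1 k \<and> trl_holds \<phi>2 k) \<or>
      trl_holds \<phi>2 k \<and> (\<exists>l\<in>{1..k}. \<nu> (Loop l) \<and> holds \<nu> (aux_release E k \<phi>1 \<phi>2 l))"
    by (subst trl.simps) (auto simp add: atLeastLessThanSuc_atLeastAtMost simp del: upt_Suc)
  ultimately show ?thesis
    by (rule bounded_until_unfold[OF assms])
qed

lemma trl_holds_next:
  assumes "i \<le> k"
  shows "trl_holds (Next \<phi>) i \<longleftrightarrow>
    (if i < k then trl_holds \<phi> (Suc i) else \<exists>l\<in>{1..k}. \<nu> (Loop l) \<and> trl_holds \<phi> l)"
  by (subst trl.simps) (simp add: atLeastLessThanSuc_atLeastAtMost del: upt_Suc)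

lemma trl_holds_prop:
  "trl_holds (Prop p) i \<longleftrightarrow> holds \<nu> (map_prop_form (StateVar i) (label_form E p))"
  "trl_holds (NProp p) i \<longleftrightarrow> \<not> holds \<nu> (map_prop_form (StateVar i) (label_form E p))"
  "trl_holds (And \<phi>1 \<phi>2) i \<longleftrightarrow> trl_holds \<phi>1 i \<and> trl_holds \<phi>2 i"
  "trl_holds (Or \<phi>1 \<phi>2) i \<longleftrightarrow> trl_holds \<phi>1 i \<or> trl_holds \<phi>2 i"
  by (simp_all add: trl.simps)

end

section \<open>Translation versus semantics on a fixed path\<close>

text \<open>Valuation and path are tied together by the atomic propositions up to \<open>k\<close>.
  This serves both directions: a valuation built from a path, and a path read off a
  valuation.\<close>

locale encoding_path = encoding_valuation \<nu> E k
  for \<nu> :: "'v enc_var \<Rightarrow> bool" and E :: "('v, 'a) symbolic" and k :: nat +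
  fixes M :: "('s, 'a) kripke_structure" and \<pi> :: "'s word"
  assumes label: "\<And>i p. i \<le> k \<Longrightarrow>
    holds \<nu> (map_prop_form (StateVar i) (label_form E p)) \<longleftrightarrow> p \<in> labels M (\<pi> i)"
begin

text \<open>The no-loop semantics supplies witnesses at positions up to \<open>k\<close>, so the
  first disjunct of each closed form applies, whichever loop variables are true.\<close>

lemma trl_holds_if_ltl_nl_at:
  assumes "i \<le> k" "ltl_nl_at M k \<pi> i \<phi>"
  shows "trl_holds \<phi> i"
  using assms
proof (induction \<phi> arbitrary: i)
  case (Until \<phi>1 \<phi>2)
  obtain j where j: "i \<le> j" "j \<le> k" "ltl_nl_at M k \<pi> j \<phi>2"
    "\<And>n. i \<le> n \<Longrightarrow> n < j \<Longrightarrow> ltl_nl_at M k \<pi> n \<phi>1"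
    using Until.prems(2) by auto
  have "trl_holds \<phi>2 j" using j Until.IH(2) by blast
  moreover have "trl_holds \<phi>1 n" if "i \<le> n" "n < j" for n
    using that j Until.IH(1)[of n] by simp
  ultimately show ?case
    using trl_holds_until[OF Until.prems(1)] j(1,2) by blast
next
  case (Release \<phi>1 \<phi>2)
  obtain j where j: "i \<le> j" "j \<le> k" "ltl_nl_at M k \<pi> j \<phi>1"
    "\<And>n. i \<le> n \<Longrightarrow> n \<le> j \<Longrightarrow> ltl_nl_at M k \<pi> n \<phi>2"
    using Release.prems(2) by auto
  have "trl_holds \<phi>1 j" using j Release.IH(1) by blast
  moreover have "trl_holds \<phi>2 n" if "i \<le> n" "n \<le> j" for n
    using that j Release.IH(2)[of n] by simp
  ultimately show ?case
    using trl_holds_release[OF Release.prems(1)] j(1,2) by auto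
qed (auto simp: trl_holds_prop trl_holds_next label)

text \<open>When the translation of an until or release relies on a selected \<open>l\<close>, the
  second pass establishes the formula at \<open>l\<close>, periodicity moves it to
  \<open>Suc k\<close>, and the one-step unfolding brings it back to \<open>i\<close>.\<close>

lemma ltl_at_if_trl_holds:
  assumes periodic: "\<And>l n. 1 \<le> l \<Longrightarrow> l \<le> k \<Longrightarrow> \<nu> (Loop l) \<Longrightarrow> \<pi> (k + n) = \<pi> (l - 1 + n)"
  assumes "i \<le> k" "trl_holds \<phi> i"
  shows "ltl_at M \<pi> i \<phi>"
proof -
  \<comment> \<open>\<open>Suc k\<close> and \<open>l\<close> are the successors of \<open>k\<close>
    and \<open>l - 1\<close>, so they start equal suffixes too.\<close>
  have wrap: "ltl_at M \<pi> (Suc k + n) \<chi> \<longleftrightarrow> ltl_at M \<pi> (l + n) \<chi>"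
    if "l \<in> {1..k}" "\<nu> (Loop l)" for l n \<chi>
  proof (rule ltl_at_suffix_cong)
    fix m show "\<pi> (Suc k + n + m) = \<pi> (l + n + m)"
      using periodic[of l "Suc (n + m)"] that by (cases l) (simp_all add: add.assoc)
  qed
  show ?thesis using assms(2,3)
  proof (induction \<phi> arbitrary: i)
    case (Next \<phi>)
    show ?case
    proof (cases "i < k")
      case False
      then obtain l where "l \<in> {1..k}" "\<nu> (Loop l)" "trl_holds \<phi> l" "i = k"
        using Next.prems by (auto simp: trl_holds_next)
      then show ?thesis using Next.IH[of l] wrap[of l 0 \<phi>] by simp
    qed (use Next in \<open>simp add: trl_holds_next\<close>)
  next
    case (Until \<phi>1 \<phi>2)
    have within: "ltl_at M \<pi> i (Until \<phi>1 \<phi>2)"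
      if "i \<le> j" "j \<le> k" "trl_holds \<phi>2 j" "\<forall>n. i \<le> n \<and> n < j \<longrightarrow> trl_holds \<phi>1 n" for i j
      using that Until.IH by (auto intro!: exI[of _ j])
    from trl_holds_until[OF Until.prems(1)] Until.prems(2) consider
      j where "i \<le> j" "j \<le> k" "trl_holds \<phi>2 j" "\<forall>n. i \<le> n \<and> n < j \<longrightarrow> trl_holds \<phi>1 n" |
      l where "\<forall>n. i \<le> n \<and> n \<le> k \<longrightarrow> trl_holds \<phi>1 n" "l \<in> {1..k}" "\<nu> (Loop l)"
        "holds \<nu> (aux_until E k \<phi>1 \<phi>2 l)"
      by blast
    then show ?case
    proof cases
      case 2
      have "ltl_at M \<pi> l (Until \<phi>1 \<phi>2)"
        using holds_aux_until[of l \<phi>1 \<phi>2] 2 within by auto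
      then have next_pass: "ltl_at M \<pi> (Suc k) (Until \<phi>1 \<phi>2)"
        using wrap[of l 0] 2 by (simp del: ltl_at.simps)
      show ?thesis using \<open>i \<le> k\<close>
      proof (induction rule: inc_induct)
        case base
        then show ?case
          using next_pass until_step[of M \<pi> k] Until.IH(1)[of k] 2(1) Until.prems(1) by blast
      next
        case (step n)
        then show ?case
          unfolding until_step[of M \<pi> n] using Until.IH(1)[of n] 2(1) by (simp del: ltl_at.simps)
      qed
    qed (rule within)
  next
    case (Release \<phi>1 \<phi>2)
    \<comment> \<open>Position \<open>j\<close> satisfies both arguments: it releases all later
      positions, and \<open>\<phi>2\<close> covers those up to and including
      \<open>j\<close>.\<close>
    have within: "ltl_at M \<pi> i (Release \<phi>1 \<phi>2)"
      if "i \<le> j" "j \<le> k" "trl_holds \<phi>1 j \<and> trl_holds \<phi>2 j"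
        "\<forall>n. i \<le> n \<and> n < j \<longrightarrow> trl_holds \<phi>2 n" for i j
    proof -
      have "ltl_at M \<pi> j \<phi>1" "\<And>n. i \<le> n \<Longrightarrow> n \<le> j \<Longrightarrow> ltl_at M \<pi> n \<phi>2"
        using that Release.IH by (auto simp: le_eq_less_or_eq)
      then show ?thesis using \<open>i \<le> j\<close> by (auto simp: not_le[symmetric])
    qed
    from trl_holds_release[OF Release.prems(1)] Release.prems(2) consider
      j where "i \<le> j" "j \<le> k" "trl_holds \<phi>1 j \<and> trl_holds \<phi>2 j"
        "\<forall>n. i \<le> n \<and> n < j \<longrightarrow> trl_holds \<phi>2 n" |
      l where "\<forall>n. i \<le> n \<and> n \<le> k \<longrightarrow> trl_holds \<phi>2 n" "l \<in> {1..k}" "\<nu> (Loop l)"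
        "holds \<nu> (aux_release E k \<phi>1 \<phi>2 l)"
      by blast
    then show ?case
    proof cases
      case 2
      have "ltl_at M \<pi> l (Release \<phi>1 \<phi>2)"
      \<comment> \<open>A release may hold because \<open>\<phi>2\<close> holds forever. If
        \<open>\<phi>2\<close> holds on all of \<open>l\<close>, ..., \<open>k\<close>, strong
        induction folds every position beyond \<open>k\<close> back by one loop length.\<close>
      proof (cases "\<forall>n. l \<le> n \<and> n \<le> k \<longrightarrow> trl_holds \<phi>2 n")
        case True
        have "ltl_at M \<pi> n \<phi>2" if "l \<le> n" for n
          using that
        proof (induction n rule: less_induct)
          case (less n)
          show ?case
          proof (cases "n \<le> k")
            case False
            then obtain m where m: "n = Suc k + m" using le_Suc_ex not_less_eq_eq by blast
            have "ltl_at M \<pi> (l + m) \<phi>2" using less.IH[of "l + m"] m 2(2) by simp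
            then show ?thesis using wrap[OF 2(2,3)] m by simp
          qed (use True less.prems Release.IH(2) in blast)
        qed
        then show ?thesis by simp
      next
        case False
        then show ?thesis
          using holds_aux_release[of l \<phi>1 \<phi>2] 2 within by auto
      qed
      then have next_pass: "ltl_at M \<pi> (Suc k) (Release \<phi>1 \<phi>2)"
        using wrap[of l 0] 2 by (simp del: ltl_at.simps)
      show ?thesis using \<open>i \<le> k\<close>
      proof (induction rule: inc_induct)
        case base
        then show ?case
          using next_pass release_step[of M \<pi> k] Release.IH(2)[of k] 2(1) Release.prems(1) by blast
      next
        case (step n)
        then show ?case
          unfolding release_step[of M \<pi> n] using Release.IH(2)[of n] 2(1) by (simp del: ltl_at.simps)
      qed
    qed (rule within)
  qed (auto simp: trl_holds_prop label)
qed

text \<open>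
  The positions \<open>l - 1\<close> and \<open>k\<close> need not start equal suffixes of \<open>\<pi>\<close>: agreement on the
  subformulas is enough, so no lasso-shaped path has to be built from \<open>\<pi>\<close>.
\<close>

lemma trl_holds_if_ltl_at:
  assumes l: "l \<in> {1..k}" "\<nu> (Loop l)"
    and agree: "\<And>\<chi>. \<chi> \<in> subformulas \<phi> \<Longrightarrow> ltl_at M \<pi> k \<chi> \<longleftrightarrow> ltl_at M \<pi> (l - 1) \<chi>"
    and fulfil: "\<And>\<chi>1 \<chi>2. Until \<chi>1 \<chi>2 \<in> subformulas \<phi> \<Longrightarrow> ltl_at M \<pi> (l - 1) (Until \<chi>1 \<chi>2) \<Longrightarrow>
      \<exists>j. l - 1 \<le> j \<and> j \<le> k \<and> ltl_at M \<pi> j \<chi>2 \<and> (\<forall>n. l - 1 \<le> n \<and> n < j \<longrightarrow> ltl_at M \<pi> n \<chi>1)"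
    and "i \<le> k" "ltl_at M \<pi> i \<phi>"
  shows "trl_holds \<phi> i"
  using agree fulfil \<open>i \<le> k\<close> \<open>ltl_at M \<pi> i \<phi>\<close>
proof (induction \<phi> arbitrary: i)
  case (Next \<phi>)
  have IH: "trl_holds \<phi> i" if "i \<le> k" "ltl_at M \<pi> i \<phi>" for i
    using that by (rule Next.IH[rotated 2]) (use Next.prems(1,2) in auto)
  show ?case
  proof (cases "i < k")
    case False
    \<comment> \<open>Agreement moves \<open>Next \<phi>\<close> from \<open>k\<close> to
      \<open>l - 1\<close>, whose successor is \<open>l\<close>.\<close>
    then have "ltl_at M \<pi> l \<phi>"
      using Next.prems(1)[of "Next \<phi>"] Next.prems(3,4) l(1) by simp
    then have "trl_holds \<phi> l" using IH l(1) by simp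
    then show ?thesis using False l trl_holds_next[OF Next.prems(3)] by auto
  next
    case True
    then show ?thesis using IH[of "Suc i"] Next.prems(3,4) by (simp add: trl_holds_next)
  qed
next
  case (Until \<phi>1 \<phi>2)
  have IH1: "trl_holds \<phi>1 i" if "i \<le> k" "ltl_at M \<pi> i \<phi>1" for i
    using that by (rule Until.IH(1)[rotated 2]) (use Until.prems(1,2) in auto)
  have IH2: "trl_holds \<phi>2 i" if "i \<le> k" "ltl_at M \<pi> i \<phi>2" for i
    using that by (rule Until.IH(2)[rotated 2]) (use Until.prems(1,2) in auto)
  obtain j where j: "i \<le> j" "ltl_at M \<pi> j \<phi>2"
    "\<And>n. i \<le> n \<Longrightarrow> n < j \<Longrightarrow> ltl_at M \<pi> n \<phi>1"
    using Until.prems(4) by auto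
  show ?case
  proof (cases "\<exists>j. i \<le> j \<and> j \<le> k \<and> ltl_at M \<pi> j \<phi>2 \<and> (\<forall>n. i \<le> n \<and> n < j \<longrightarrow> ltl_at M \<pi> n \<phi>1)")
    case True
    then obtain j where "i \<le> j" "j \<le> k" "trl_holds \<phi>2 j" "\<forall>n. i \<le> n \<and> n < j \<longrightarrow> trl_holds \<phi>1 n"
      using IH1 IH2 by (auto dest!: less_imp_le)
    then show ?thesis using trl_holds_until[OF Until.prems(3)] by blast
  next
    case unfulfilled: False
    then have "k < j" using j by (meson not_le)
    have now: "\<forall>n. i \<le> n \<and> n \<le> k \<longrightarrow> ltl_at M \<pi> n \<phi>1" using j(3) \<open>k < j\<close> by simp
    \<comment> \<open>The until is still pending at \<open>k\<close>, hence true at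
      \<open>l - 1\<close> by agreement, and the fulfilment assumption gives a witness not beyond
      \<open>k\<close>.\<close>
    have "ltl_at M \<pi> k (Until \<phi>1 \<phi>2)"
      using j \<open>k < j\<close> Until.prems(3) by (auto intro!: exI[of _ j])
    then have "ltl_at M \<pi> (l - 1) (Until \<phi>1 \<phi>2)" using Until.prems(1)[of "Until \<phi>1 \<phi>2"] by simp
    then obtain m where m: "l - 1 \<le> m" "m \<le> k" "ltl_at M \<pi> m \<phi>2"
      "\<And>n. l - 1 \<le> n \<Longrightarrow> n < m \<Longrightarrow> ltl_at M \<pi> n \<phi>1"
      using Until.prems(2)[of \<phi>1 \<phi>2] by auto
    \<comment> \<open>The second pass starts at \<open>l\<close>, so a witness at
      \<open>l - 1\<close> would come too early. It is excluded because \<open>\<phi>2\<close> fails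
      at \<open>k\<close> and therefore at \<open>l - 1\<close>.\<close>
    have "\<not> ltl_at M \<pi> k \<phi>2" using unfulfilled now Until.prems(3) by auto
    then have "m \<noteq> l - 1" using m(3) Until.prems(1)[of \<phi>2] by auto
    then have "l \<le> m" using m(1) by simp
    then have "holds \<nu> (aux_until E k \<phi>1 \<phi>2 l)"
      using m IH1 IH2 l(1) by (subst holds_aux_until) (auto intro!: exI[of _ m])
    then show ?thesis
      using trl_holds_until[OF Until.prems(3), of \<phi>1 \<phi>2] now IH1 l by blast
  qed
next
  case (Release \<phi>1 \<phi>2)
  have IH1: "trl_holds \<phi>1 i" if "i \<le> k" "ltl_at M \<pi> i \<phi>1" for i
    using that by (rule Release.IH(1)[rotated 2]) (use Release.prems(1,2) in auto)
  have IH2: "trl_holds \<phi>2 i" if "i \<le> k" "ltl_at M \<pi> i \<phi>2" for i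
    using that by (rule Release.IH(2)[rotated 2]) (use Release.prems(1,2) in auto)
  \<comment> \<open>Either there is a least position up to \<open>k\<close> that satisfies
    \<open>\<phi>1\<close>, and \<open>\<phi>2\<close> must hold up to and including it, or
    \<open>\<phi>1\<close> fails and \<open>\<phi>2\<close> holds all the way to
    \<open>k\<close>.\<close>
  have split: "(\<exists>j. i \<le> j \<and> j \<le> k \<and> (trl_holds \<phi>1 j \<and> trl_holds \<phi>2 j) \<and>
       (\<forall>n. i \<le> n \<and> n < j \<longrightarrow> trl_holds \<phi>2 n)) \<or>
      (\<forall>n. i \<le> n \<and> n \<le> k \<longrightarrow> \<not> ltl_at M \<pi> n \<phi>1 \<and> ltl_at M \<pi> n \<phi>2)"
    if R: "ltl_at M \<pi> i (Release \<phi>1 \<phi>2)" for i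
  proof (cases "\<exists>j. i \<le> j \<and> j \<le> k \<and> ltl_at M \<pi> j \<phi>1")
    case True
    then obtain j where j: "i \<le> j" "j \<le> k" "ltl_at M \<pi> j \<phi>1"
      "\<And>n. i \<le> n \<Longrightarrow> n < j \<Longrightarrow> \<not> ltl_at M \<pi> n \<phi>1"
      using exists_least_iff[of "\<lambda>j. i \<le> j \<and> j \<le> k \<and> ltl_at M \<pi> j \<phi>1"] by auto
    have "ltl_at M \<pi> n \<phi>2" if "i \<le> n" "n \<le> j" for n
      using R j(4) that by (auto dest: less_le_trans)
    then show ?thesis using j IH1 IH2 by (intro disjI1 exI[of _ j]) simp
  next
    case False
    then show ?thesis using R by (auto dest: less_imp_le less_le_trans)
  qed
  show ?case
  proof (rule ccontr)
    assume contra: "\<not> ?case"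
    then have none: "\<forall>n. i \<le> n \<and> n \<le> k \<longrightarrow> \<not> ltl_at M \<pi> n \<phi>1 \<and> ltl_at M \<pi> n \<phi>2"
      using split[OF Release.prems(4)] trl_holds_release[OF Release.prems(3), of \<phi>1 \<phi>2] by blast
    \<comment> \<open>The obligation stays pending up to \<open>k\<close>, returns to
      \<open>l - 1\<close> by agreement, and passes on to \<open>l\<close> because
      \<open>\<phi>1\<close> fails at \<open>l - 1\<close> just as it does at
      \<open>k\<close>.\<close>
    have "ltl_at M \<pi> k (Release \<phi>1 \<phi>2)"
      using Release.prems(3)
    proof (induction rule: dec_induct)
      case base
      show ?case by (rule Release.prems(4))
    next
      case (step n)
      then show ?case using none unfolding release_step[of M \<pi> n] by (simp del: ltl_at.simps)
    qed
    then have "ltl_at M \<pi> (l - 1) (Release \<phi>1 \<phi>2)"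
      using Release.prems(1)[of "Release \<phi>1 \<phi>2"] by simp
    moreover have "\<not> ltl_at M \<pi> (l - 1) \<phi>1"
      using Release.prems(1)[of \<phi>1] none Release.prems(3) by simp
    ultimately have "ltl_at M \<pi> l (Release \<phi>1 \<phi>2)"
      using release_step[of M \<pi> "l - 1"] l(1) by (simp del: ltl_at.simps)
    then have "holds \<nu> (aux_release E k \<phi>1 \<phi>2 l)"
      using split[of l] holds_aux_release[of l \<phi>1 \<phi>2] IH2 l(1) by auto
    then show False
      using contra trl_holds_release[OF Release.prems(3), of \<phi>1 \<phi>2] none IH2 l by blast
  qed
qed (auto simp: trl_holds_prop label)

end

section \<open>Models of the encoding\<close>

lemma holds_model_constraints:
  "holds \<nu> (model_constraints E k) \<longleftrightarrow>
     holds (\<lambda>v. \<nu> (StateVar 0 v)) (init_form E) \<and> (\<forall>i<k. holds \<nu> (trans_at E i (Suc i)))"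
proof -
  have "{Suc 0..<Suc k} = Suc ` {..<k}"
    using image_Suc_lessThan[of k] by (simp add: atLeastLessThanSuc_atLeastAtMost)
  then have "(\<forall>i\<in>{Suc 0..<Suc k}. holds \<nu> (trans_at E (i - Suc 0) i)) \<longleftrightarrow>
      (\<forall>i<k. holds \<nu> (trans_at E i (Suc i)))"
    by (simp only: ball_simps diff_Suc_1') auto
  then show ?thesis
    by (simp add: model_constraints_def holds_map_prop_form comp_def del: upt_Suc)
qed

lemma holds_state_eq:
  "holds \<nu> (state_eq E i j) \<longleftrightarrow>
     (\<forall>v\<in>set (state_vars E). \<nu> (StateVar i v) \<longleftrightarrow> \<nu> (StateVar j v))"
  by (simp add: state_eq_def)

lemma holds_loop_constraints:
  "holds \<nu> (loop_constraints E k) \<longleftrightarrow>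
     \<not> \<nu> (Loop 0) \<and> \<not> \<nu> (InLoop 0) \<and> (\<nu> LoopExists \<longleftrightarrow> \<nu> (InLoop k)) \<and>
     (\<forall>i\<in>{1..k}.
        (\<nu> (Loop i) \<longrightarrow> holds \<nu> (state_eq E (i - 1) k)) \<and>
        (\<nu> (InLoop i) \<longleftrightarrow> \<nu> (InLoop (i - 1)) \<or> \<nu> (Loop i)) \<and>
        (\<nu> (InLoop (i - 1)) \<longrightarrow> \<not> \<nu> (Loop i)))"
  by (simp add: loop_constraints_def ball_Un atLeastLessThanSuc_atLeastAtMost del: upt_Suc)

text \<open>Once some \<open>Loop i\<close> is true, \<open>InLoop\<close> is true from
  \<open>i\<close> on, and this forbids every later loop variable.\<close>

lemma loop_unique:
  assumes "holds \<nu> (loop_constraints E k)"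
    and "l \<in> {1..k}" "\<nu> (Loop l)" "l' \<in> {1..k}" "\<nu> (Loop l')"
  shows "l = l'"
proof -
  have inloop: "\<nu> (InLoop i) \<longleftrightarrow> \<nu> (InLoop (i - 1)) \<or> \<nu> (Loop i)"
    and once: "\<nu> (InLoop (i - 1)) \<Longrightarrow> \<not> \<nu> (Loop i)" if "i \<in> {1..k}" for i
    using assms(1) that unfolding holds_loop_constraints by blast+
  have "\<not> \<nu> (Loop j)" if loop: "\<nu> (Loop i)" and ij: "1 \<le> i" "i < j" "j \<le> k" for i j
  proof -
    have "i \<le> j - 1" using ij by simp
    then have "\<nu> (InLoop (j - 1))"
    proof (induction rule: dec_induct)
      case base
      show ?case using inloop[of i] loop ij by auto
    next
      case (step n)
      then show ?case using inloop[of "Suc n"] ij by auto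
    qed
    then show ?thesis using once[of j] ij by auto
  qed
  then show ?thesis using assms(2-5) by (metis atLeastAtMost_iff linorder_neqE_nat)
qed

lemma holds_trans_at:
  assumes "represents enc E M"
  shows "holds \<nu> (trans_at E i j) \<longleftrightarrow>
    (\<exists>(s, t)\<in>transitions M.
       encodes enc (state_vars E) s (\<lambda>v. \<nu> (StateVar i v)) \<and>
       encodes enc (state_vars E) t (\<lambda>v. \<nu> (StateVar j v)))"
proof -
  have "holds u (trans_form E) \<longleftrightarrow>
      (\<exists>(s, t)\<in>transitions M.
         encodes enc (state_vars E) s (\<lambda>v. u (Cur v)) \<and>
         encodes enc (state_vars E) t (\<lambda>v. u (Nxt v)))" for u
    using assms by (simp add: represents_def)
  from this[of "\<nu> \<circ> case_trans_var (StateVar i) (StateVar j)"] show ?thesis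
    by (simp add: trans_at_def holds_map_prop_form)
qed

lemma encodes_unique:
  assumes "represents enc E M" "s \<in> states M" "t \<in> states M"
    and "encodes enc (state_vars E) s u" "encodes enc (state_vars E) t u"
  shows "s = t"
proof -
  have "encodes enc (state_vars E) s (enc t)"
    using assms(4,5) by (simp add: encodes_def)
  then show ?thesis using assms(1-3) by (simp add: represents_def)
qed

lemma encoding_path_if_encodes:
  assumes "represents enc E M" "\<And>i. i \<le> k \<Longrightarrow> \<pi> i \<in> states M"
    and "\<And>i. i \<le> k \<Longrightarrow> encodes enc (state_vars E) (\<pi> i) (\<lambda>v. \<nu> (StateVar i v))"
  shows "encoding_path \<nu> E k M \<pi>"
proof
  fix i p assume i: "i \<le> k"
  have vars: "set_prop_form (label_form E p) \<subseteq> set (state_vars E)"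
    and label: "\<And>s. s \<in> states M \<Longrightarrow> holds (enc s) (label_form E p) \<longleftrightarrow> p \<in> labels M s"
    using assms(1) by (auto simp: represents_def)
  have "holds (\<lambda>v. \<nu> (StateVar i v)) (label_form E p) \<longleftrightarrow> holds (enc (\<pi> i)) (label_form E p)"
    using vars assms(3)[OF i] by (intro holds_cong) (auto simp: encodes_def)
  then show "holds \<nu> (map_prop_form (StateVar i) (label_form E p)) \<longleftrightarrow> p \<in> labels M (\<pi> i)"
    using label assms(2)[OF i] by (simp add: holds_map_prop_form comp_def)
qed

lemma infinite_path_in_states:
  assumes "kripke M" "infinite_path M \<pi>"
  shows "\<pi> i \<in> states M"
  using assms by (auto simp: kripke_def infinite_path_def)

lemma kripke_trans:
  assumes "kripke M" "(s, t) \<in> transitions M"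
  shows "s \<in> states M" "t \<in> states M"
  using assms by (auto simp: kripke_def)

section \<open>From an initialised path to a satisfying valuation\<close>

text \<open>The argument \<open>l = 0\<close> stands for the valuation that selects no loop.\<close>

fun path_valuation :: "('s \<Rightarrow> 'v \<Rightarrow> bool) \<Rightarrow> 's word \<Rightarrow> nat \<Rightarrow> nat \<Rightarrow> 'v enc_var \<Rightarrow> bool" where
  "path_valuation enc \<pi> k l (StateVar i v) = enc (\<pi> i) v"
| "path_valuation enc \<pi> k l (Loop i) = (0 < l \<and> i = l)"
| "path_valuation enc \<pi> k l (InLoop i) = (0 < l \<and> l \<le> i)"
| "path_valuation enc \<pi> k l LoopExists = (0 < l \<and> l \<le> k)"

lemma encodes_path_valuation:
  "encodes enc vs (\<pi> i) (\<lambda>v. path_valuation enc \<pi> k l (StateVar i v))"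
  by (simp add: encodes_def)

lemma path_valuation_constraints:
  assumes "represents enc E M" "initialised_path M \<pi>"
    and "0 < l \<Longrightarrow> l \<le> k \<Longrightarrow> \<pi> (l - 1) = \<pi> k"
  shows "holds (path_valuation enc \<pi> k l) (model_constraints E k)"
    and "holds (path_valuation enc \<pi> k l) (loop_constraints E k)"
proof -
  have "holds (path_valuation enc \<pi> k l) (trans_at E i (Suc i))" for i
    using holds_trans_at[OF assms(1)] assms(2) encodes_path_valuation
    unfolding initialised_path_def infinite_path_def by fast
  moreover have "holds (\<lambda>v. path_valuation enc \<pi> k l (StateVar 0 v)) (init_form E)"
    using assms(1,2) encodes_path_valuation unfolding represents_def initialised_path_def by metis
  ultimately show "holds (path_valuation enc \<pi> k l) (model_constraints E k)"
    by (simp add: holds_model_constraints)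
  show "holds (path_valuation enc \<pi> k l) (loop_constraints E k)"
    using assms(3) by (auto simp: holds_loop_constraints holds_state_eq)
qed

lemma satisfiable_encoding_path_valuation:
  assumes "represents enc E M" "initialised_path M \<pi>"
    and "0 < l \<Longrightarrow> l \<le> k \<Longrightarrow> \<pi> (l - 1) = \<pi> k"
    and "holds (path_valuation enc \<pi> k l) (trl E k \<psi> 0)"
  shows "satisfiable (encoding E \<psi> k)"
  using path_valuation_constraints[OF assms(1,2,3)] assms(4)
  by (auto simp: satisfiable_def encoding_def)

lemma encoding_path_path_valuation:
  assumes "kripke M" "represents enc E M" "initialised_path M \<pi>"
  shows "encoding_path (path_valuation enc \<pi> k l) E k M \<pi>"
  using assms infinite_path_in_states encodes_path_valuation
  by (intro encoding_path_if_encodes) (auto simp: initialised_path_def)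

text \<open>With no loop selected, the loop constraints hold on every path, and witnesses within
  \<open>k\<close> are all that the translation asks for.\<close>

lemma satisfiable_encoding_if_ltl_nl_at:
  assumes "kripke M" "represents enc E M" "initialised_path M \<pi>" "ltl_nl_at M k \<pi> 0 \<psi>"
  shows "satisfiable (encoding E \<psi> k)"
proof -
  interpret encoding_path "path_valuation enc \<pi> k 0" E k M \<pi>
    using assms(1-3) by (rule encoding_path_path_valuation)
  show ?thesis
    using assms trl_holds_if_ltl_nl_at by (intro satisfiable_encoding_path_valuation[of _ _ _ _ 0]) auto
qed

lemma satisfiable_encoding_if_ltl_at:
  assumes "kripke M" "represents enc E M" "initialised_path M \<pi>"
    and "l \<in> {1..k}" "\<pi> (l - 1) = \<pi> k"
    and "\<And>\<chi>. \<chi> \<in> subformulas \<psi> \<Longrightarrow> ltl_at M \<pi> k \<chi> \<longleftrightarrow> ltl_at M \<pi> (l - 1) \<chi>"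
    and "\<And>\<chi>1 \<chi>2. Until \<chi>1 \<chi>2 \<in> subformulas \<psi> \<Longrightarrow> ltl_at M \<pi> (l - 1) (Until \<chi>1 \<chi>2) \<Longrightarrow>
      \<exists>j. l - 1 \<le> j \<and> j \<le> k \<and> ltl_at M \<pi> j \<chi>2 \<and> (\<forall>n. l - 1 \<le> n \<and> n < j \<longrightarrow> ltl_at M \<pi> n \<chi>1)"
    and "ltl_at M \<pi> 0 \<psi>"
  shows "satisfiable (encoding E \<psi> k)"
proof -
  interpret encoding_path "path_valuation enc \<pi> k l" E k M \<pi>
    using assms(1-3) by (rule encoding_path_path_valuation)
  have "holds (path_valuation enc \<pi> k l) (trl E k \<psi> 0)"
    using assms(4) by (intro trl_holds_if_ltl_at[OF assms(4) _ assms(6,7) _ assms(8)]) auto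
  then show ?thesis
    using assms by (intro satisfiable_encoding_path_valuation[of _ _ _ _ l]) auto
qed

text \<open>The defining equation gives period \<open>Suc k - l\<close> from position
  \<open>l\<close> on; the condition \<open>\<pi> (l - 1) = \<pi> k\<close> extends it one position
  to the left.\<close>

lemma kl_loop_periodic:
  assumes "kl_loop \<pi> k l"
  shows "\<pi> (k + n) = \<pi> (l - 1 + n)"
proof (cases n)
  case (Suc m)
  have l: "0 < l" "l \<le> k" and \<pi>: "\<pi> = map \<pi> [0..<l] \<frown> (map \<pi> [l..<Suc k])\<^sup>\<omega>"
    using assms by (auto simp: kl_loop_def)
  have iter: "\<pi> (l + i) = (map \<pi> [l..<Suc k])\<^sup>\<omega> i" for i
    by (subst \<pi>) (simp add: conc_def del: upt_Suc)
  have "u\<^sup>\<omega> (length u + m) = u\<^sup>\<omega> m" if "u \<noteq> []" for u :: "'a list"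
    using that by (simp add: iter_def)
  from this[of "map \<pi> [l..<Suc k]"] have "\<pi> (l + (Suc k - l + m)) = \<pi> (l + m)"
    unfolding iter using l by (simp del: upt_Suc)
  then show ?thesis using l Suc by simp
qed (use assms in \<open>simp add: kl_loop_def\<close>)

lemma satisfiable_encoding_if_kl_loop:
  assumes "kripke M" "represents enc E M" "initialised_path M \<pi>"
    and loop: "kl_loop \<pi> k l" and sat: "ltl_at M \<pi> 0 \<psi>"
  shows "satisfiable (encoding E \<psi> k)"
proof (rule satisfiable_encoding_if_ltl_at[OF assms(1-3) _ _ _ _ sat])
  show l: "l \<in> {1..k}" and "\<pi> (l - 1) = \<pi> k"
    using loop by (auto simp: kl_loop_def)
  have shift: "ltl_at M \<pi> (k + n) \<chi> \<longleftrightarrow> ltl_at M \<pi> (l - 1 + n) \<chi>" for n \<chi>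
    using kl_loop_periodic[OF loop] by (intro ltl_at_suffix_cong) (simp add: add.assoc)
  show "ltl_at M \<pi> k \<chi> \<longleftrightarrow> ltl_at M \<pi> (l - 1) \<chi>" for \<chi>
    using shift[of 0] by simp
  show "\<exists>j. l - 1 \<le> j \<and> j \<le> k \<and> ltl_at M \<pi> j \<chi>2 \<and> (\<forall>n. l - 1 \<le> n \<and> n < j \<longrightarrow> ltl_at M \<pi> n \<chi>1)"
    if "ltl_at M \<pi> (l - 1) (Until \<chi>1 \<chi>2)" for \<chi>1 \<chi>2
  proof -
    \<comment> \<open>The first fulfilment lies within \<open>k\<close>, since one at
      \<open>k + n\<close> beyond \<open>k\<close> would have an earlier copy at
      \<open>l - 1 + n\<close>.\<close>
    let ?P = "\<lambda>j. l - 1 \<le> j \<and> ltl_at M \<pi> j \<chi>2 \<and> (\<forall>n. l - 1 \<le> n \<and> n < j \<longrightarrow> ltl_at M \<pi> n \<chi>1)"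
    have "\<exists>j. ?P j" using that by auto
    then obtain j where j: "?P j" and least: "\<forall>i<j. \<not> ?P i"
      using exists_least_iff[of ?P] by blast
    have "j \<le> k"
    proof (rule ccontr)
      assume "\<not> j \<le> k"
      then obtain n where n: "j = k + n" by (metis le_add_diff_inverse nat_le_linear)
      have "l - 1 + n < j" using n l by auto
      moreover have "?P (l - 1 + n)" using j shift[of n \<chi>2] n \<open>l - 1 + n < j\<close> by auto
      ultimately show False using least by blast
    qed
    then show ?thesis using j by blast
  qed
qed

lemma satisfiable_encoding_if_ltl_sat:
  assumes "kripke M" "represents enc E M" "initialised_path M \<pi>" and sat: "ltl_at M \<pi> 0 \<psi>"
  shows "\<exists>k. satisfiable (encoding E \<psi> k)"
proof -
  \<comment> \<open>The atom of a position collects what the two ends of the loop must share. There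
    are finitely many atoms, so one of them recurs infinitely often.\<close>
  define atom where "atom i = (\<pi> i, {\<chi> \<in> subformulas \<psi>. ltl_at M \<pi> i \<chi>})" for i
  have "range atom \<subseteq> states M \<times> Pow (subformulas \<psi>)"
    using infinite_path_in_states assms(1,3) by (auto simp: atom_def initialised_path_def)
  then have "finite (range atom)"
    using assms(1) finite_subformulas unfolding kripke_def
    by (meson finite_Pow_iff finite_SigmaI finite_subset)
  then obtain p where p: "infinite {q. atom q = atom p}"
    using pigeonhole_infinite[of UNIV atom] by auto
  \<comment> \<open>For formulas other than until the condition shrinks to \<open>p \<le> j\<close>,
    so that a single choice function covers all formulas true at \<open>p\<close>.\<close>
  define wit where "wit \<chi> j \<longleftrightarrow> p \<le> j \<and> (case \<chi> of
      Until \<chi>1 \<chi>2 \<Rightarrow> ltl_at M \<pi> j \<chi>2 \<and> (\<forall>n. p \<le> n \<and> n < j \<longrightarrow> ltl_at M \<pi> n \<chi>1) | _ \<Rightarrow> True)"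
    for \<chi> j
  have "\<exists>j. wit \<chi> j" if "ltl_at M \<pi> p \<chi>" for \<chi>
    using that by (cases \<chi>) (auto simp: wit_def)
  then obtain j where j: "\<And>\<chi>. ltl_at M \<pi> p \<chi> \<Longrightarrow> wit \<chi> (j \<chi>)" by metis
  \<comment> \<open>By position \<open>N\<close> every until subformula true at \<open>p\<close> has
    been fulfilled; a recurrence of the atom beyond \<open>N\<close> closes the loop.\<close>
  define N where "N = Max (insert p (j ` subformulas \<psi>))"
  have N: "p \<le> N" "\<And>\<chi>. \<chi> \<in> subformulas \<psi> \<Longrightarrow> j \<chi> \<le> N"
    using finite_subformulas by (auto simp: N_def intro: Max_ge)
  obtain k where "N < k" and k: "atom k = atom p"
    using p unfolding infinite_nat_iff_unbounded by blast
  have "satisfiable (encoding E \<psi> k)"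
  \<comment> \<open>The loop variable names the first position inside the loop, so the repeated
    position \<open>p\<close> is \<open>l - 1\<close> for \<open>l = Suc p\<close>.\<close>
  proof (rule satisfiable_encoding_if_ltl_at[OF assms(1-3) _ _ _ _ sat, where l = "Suc p"])
    show "Suc p \<in> {1..k}" using \<open>N < k\<close> N(1) by simp
    show "\<pi> (Suc p - 1) = \<pi> k" using k by (simp add: atom_def)
    show "ltl_at M \<pi> k \<chi> \<longleftrightarrow> ltl_at M \<pi> (Suc p - 1) \<chi>" if "\<chi> \<in> subformulas \<psi>" for \<chi>
      using k that by (auto simp: atom_def)
    show "\<exists>j. Suc p - 1 \<le> j \<and> j \<le> k \<and> ltl_at M \<pi> j \<chi>2 \<and>
        (\<forall>n. Suc p - 1 \<le> n \<and> n < j \<longrightarrow> ltl_at M \<pi> n \<chi>1)"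
      if "Until \<chi>1 \<chi>2 \<in> subformulas \<psi>" "ltl_at M \<pi> (Suc p - 1) (Until \<chi>1 \<chi>2)" for \<chi>1 \<chi>2
    proof -
      have "wit (Until \<chi>1 \<chi>2) (j (Until \<chi>1 \<chi>2))" using that(2) by (intro j) simp
      moreover have "j (Until \<chi>1 \<chi>2) \<le> k" using N(2)[OF that(1)] \<open>N < k\<close> by simp
      ultimately show ?thesis unfolding wit_def by auto
    qed
  qed
  then show ?thesis ..
qed

section \<open>From a satisfying valuation to an initialised path\<close>

lemma lasso_path:
  assumes "l \<in> {1..k}" and "\<And>i. i < k \<Longrightarrow> (s i, s (Suc i)) \<in> transitions M" and "s (l - 1) = s k"
  shows "\<exists>\<pi>. infinite_path M \<pi> \<and> (\<forall>i\<le>k. \<pi> i = s i) \<and> (\<forall>n. \<pi> (k + n) = \<pi> (l - 1 + n))"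
proof -
  define d where "d = Suc k - l"
  define \<pi> where "\<pi> i = (if i < l then s i else s (l + (i - l) mod d))" for i
  have d: "0 < d" "l + d = Suc k" using assms(1) by (auto simp: d_def)
  have init: "\<pi> i = s i" if "i \<le> k" for i
    using that d by (auto simp: \<pi>_def)
  have periodic: "\<pi> (k + n) = \<pi> (l - 1 + n)" for n
  proof (cases n)
    case 0
    then show ?thesis using assms(1,3) init[of k] init[of "l - 1"] by auto
  next
    case (Suc m)
    then have "k + n = l + d + m" "l - 1 + n = l + m" using d assms(1) by auto
    then show ?thesis by (simp add: \<pi>_def)
  qed
  have "infinite_path M \<pi>"
    unfolding infinite_path_def
  proof
    fix i
    show "(\<pi> i, \<pi> (Suc i)) \<in> transitions M"
    proof (cases "i < k")
      case True
      then show ?thesis using assms(2) init[of i] init[of "Suc i"] by simp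
    next
      case False
      then obtain m where i: "i = l + m" using assms(1) by (metis atLeastAtMost_iff le_Suc_ex le_trans not_less)
      show ?thesis
      proof (cases "Suc (m mod d) = d")
        case True
        \<comment> \<open>End of a lap: the current state is \<open>s k\<close>, which equals
          \<open>s (l - 1)\<close>, so the transition back to \<open>s l\<close> is the one from
          \<open>l - 1\<close> to \<open>l\<close>.\<close>
        then have "l + m mod d = k" using d by simp
        then have "\<pi> i = s (l - 1)" "\<pi> (Suc i) = s l"
          using i True assms(3) by (simp_all add: \<pi>_def mod_Suc)
        then show ?thesis using assms(2)[of "l - 1"] assms(1) by (cases l) auto
      next
        case False
        then have "l + m mod d < k" using d mod_less_divisor[OF d(1), of m] by linarith
        then show ?thesis
          using i False assms(2)[of "l + m mod d"] by (simp add: \<pi>_def mod_Suc)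
      qed
    qed
  qed
  then show ?thesis using init periodic by blast
qed

text \<open>Totality of the transition relation yields a successor function, and iterating it from
  \<open>s k\<close> continues the finite path forever.\<close>

lemma extend_path:
  assumes "kripke M" "s k \<in> states M" "\<And>i. i < k \<Longrightarrow> (s i, s (Suc i)) \<in> transitions M"
  shows "\<exists>\<pi>. infinite_path M \<pi> \<and> (\<forall>i\<le>k. \<pi> i = s i)"
proof -
  obtain f where f: "\<And>t. t \<in> states M \<Longrightarrow> (t, f t) \<in> transitions M"
    using assms(1) unfolding kripke_def by metis
  define \<pi> where "\<pi> i = (if i \<le> k then s i else (f ^^ (i - k)) (s k))" for i
  have in_states: "(f ^^ n) (s k) \<in> states M" for n
    using assms(2) f kripke_trans(2)[OF assms(1)] by (induction n) auto
  have "(\<pi> i, \<pi> (Suc i)) \<in> transitions M" for i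
  proof (cases "i < k")
    case False
    then show ?thesis
      using f[OF in_states[of "i - k"]] by (auto simp: \<pi>_def Suc_diff_le)
  qed (use assms(3) in \<open>simp add: \<pi>_def\<close>)
  then have "infinite_path M \<pi>" by (simp add: infinite_path_def)
  moreover have "\<pi> i = s i" if "i \<le> k" for i
    using that by (simp add: \<pi>_def)
  ultimately show ?thesis by blast
qed

text \<open>Each transition constraint yields its own pair of states. Neighbouring pairs fit
  together because one copy of the state variables encodes at most one state.\<close>

lemma path_of_constraints:
  assumes "kripke M" "represents enc E M"
    and "holds \<nu> (model_constraints E k)" "holds \<nu> (loop_constraints E k)"
  obtains \<pi> where "initialised_path M \<pi>" "encoding_path \<nu> E k M \<pi>"
    "\<And>l n. 1 \<le> l \<Longrightarrow> l \<le> k \<Longrightarrow> \<nu> (Loop l) \<Longrightarrow> \<pi> (k + n) = \<pi> (l - 1 + n)"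
proof -
  let ?enc = "\<lambda>s i. encodes enc (state_vars E) s (\<lambda>v. \<nu> (StateVar i v))"
  note unique = encodes_unique[OF assms(2)]
  have trans: "\<exists>(s, t)\<in>transitions M. ?enc s i \<and> ?enc t (Suc i)" if "i < k" for i
    using assms(3) that holds_trans_at[OF assms(2)] unfolding holds_model_constraints by blast
  obtain s0 where s0: "s0 \<in> initial M" "?enc s0 0"
    using assms(2,3) unfolding holds_model_constraints represents_def by blast
  have "\<exists>s\<in>states M. ?enc s i" if "i \<le> k" for i
  proof (cases i)
    case 0
    then show ?thesis using s0 assms(1) by (auto simp: kripke_def)
  next
    case (Suc n)
    then show ?thesis using trans[of n] that kripke_trans(2)[OF assms(1)] by fastforce
  qed
  then obtain s where s: "\<And>i. i \<le> k \<Longrightarrow> s i \<in> states M" "\<And>i. i \<le> k \<Longrightarrow> ?enc (s i) i"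
    using bchoice[of "{..k}" "\<lambda>i s. s \<in> states M \<and> ?enc s i"] by auto
  have step: "(s i, s (Suc i)) \<in> transitions M" if i: "i < k" for i
  proof -
    obtain t t' where t: "(t, t') \<in> transitions M" "?enc t i" "?enc t' (Suc i)"
      using trans[OF i] by blast
    have "t = s i"
      using unique[OF kripke_trans(1)[OF assms(1) t(1)] s(1) t(2) s(2)] i by simp
    moreover have "t' = s (Suc i)"
      using unique[OF kripke_trans(2)[OF assms(1) t(1)] s(1) t(3) s(2)] i by simp
    ultimately show ?thesis using t(1) by simp
  qed
  have "s0 \<in> states M" using s0(1) assms(1) by (auto simp: kripke_def)
  then have "s 0 = s0"
    using unique[OF s(1) _ s(2) s0(2)] by simp
  have "\<exists>\<pi>. infinite_path M \<pi> \<and> (\<forall>i\<le>k. \<pi> i = s i) \<and>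
    (\<forall>l n. 1 \<le> l \<and> l \<le> k \<and> \<nu> (Loop l) \<longrightarrow> \<pi> (k + n) = \<pi> (l - 1 + n))"
  proof (cases "\<exists>l\<in>{1..k}. \<nu> (Loop l)")
    case True
    then obtain l where l: "l \<in> {1..k}" "\<nu> (Loop l)" by blast
    have "l - 1 \<le> k" using l(1) by auto
    \<comment> \<open>Copies \<open>l - 1\<close> and \<open>k\<close> agree on the state variables,
      so copy \<open>k\<close> encodes \<open>s (l - 1)\<close> as well as \<open>s k\<close>, and
      the two coincide.\<close>
    have "holds \<nu> (state_eq E (l - 1) k)"
      using assms(4)[unfolded holds_loop_constraints, THEN conjunct2, THEN conjunct2,
          THEN conjunct2, rule_format, OF l(1)] l(2) by blast
    then have "?enc (s (l - 1)) k"
      using s(2)[OF \<open>l - 1 \<le> k\<close>] unfolding holds_state_eq encodes_def by blast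
    then have "s (l - 1) = s k"
      by (rule unique[OF s(1)[OF \<open>l - 1 \<le> k\<close>] s(1)[OF order_refl] _ s(2)[OF order_refl]])
    with l(1) step have "\<exists>\<pi>. infinite_path M \<pi> \<and> (\<forall>i\<le>k. \<pi> i = s i) \<and>
        (\<forall>n. \<pi> (k + n) = \<pi> (l - 1 + n))"
      by (rule lasso_path)
    then obtain \<pi> where \<pi>: "infinite_path M \<pi>" "\<forall>i\<le>k. \<pi> i = s i"
      "\<And>n. \<pi> (k + n) = \<pi> (l - 1 + n)"
      by blast
    \<comment> \<open>The lasso was built for one \<open>l\<close>; uniqueness of the selected loop
      turns this into periodicity for every selected \<open>l'\<close>.\<close>
    have "\<pi> (k + n) = \<pi> (l' - 1 + n)" if "1 \<le> l'" "l' \<le> k" "\<nu> (Loop l')" for l' n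
    proof -
      have "l' = l" using loop_unique[OF assms(4) _ _ l] that by simp
      then show ?thesis using \<pi>(3) by simp
    qed
    then show ?thesis using \<pi>(1,2) by blast
  next
    case False
    from assms(1) s(1)[OF order_refl] step
    have "\<exists>\<pi>. infinite_path M \<pi> \<and> (\<forall>i\<le>k. \<pi> i = s i)"
      by (rule extend_path)
    then show ?thesis using False by auto
  qed
  then obtain \<pi> where \<pi>: "infinite_path M \<pi>" "\<And>i. i \<le> k \<Longrightarrow> \<pi> i = s i"
    "\<And>l n. 1 \<le> l \<Longrightarrow> l \<le> k \<Longrightarrow> \<nu> (Loop l) \<Longrightarrow> \<pi> (k + n) = \<pi> (l - 1 + n)"
    by blast
  show ?thesis
  proof
    show "initialised_path M \<pi>"
      using \<pi>(1,2) s0(1) \<open>s 0 = s0\<close> by (simp add: initialised_path_def)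
    show "encoding_path \<nu> E k M \<pi>"
      using s \<pi>(2) by (intro encoding_path_if_encodes[OF assms(2)]) simp_all
  qed (fact \<pi>(3))
qed

lemma ltl_sat_if_satisfiable_encoding:
  assumes "kripke M" "represents enc E M" "satisfiable (encoding E \<psi> k)"
  shows "\<exists>\<pi>. initialised_path M \<pi> \<and> ltl_sat M \<pi> \<psi>"
proof -
  obtain \<nu> where \<nu>: "holds \<nu> (model_constraints E k)" "holds \<nu> (loop_constraints E k)"
    "holds \<nu> (trl E k \<psi> 0)"
    using assms(3) by (auto simp: satisfiable_def encoding_def)
  obtain \<pi> where \<pi>: "initialised_path M \<pi>" "encoding_path \<nu> E k M \<pi>"
    and loops: "\<And>l n. 1 \<le> l \<Longrightarrow> l \<le> k \<Longrightarrow> \<nu> (Loop l) \<Longrightarrow> \<pi> (k + n) = \<pi> (l - 1 + n)"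
    using path_of_constraints[OF assms(1,2) \<nu>(1,2)] by blast
  have "ltl_at M \<pi> 0 \<psi>"
    using encoding_path.ltl_at_if_trl_holds[OF \<pi>(2) loops _ \<nu>(3)] by simp
  then show ?thesis using \<pi>(1) by (auto simp: ltl_sat_def)
qed

theorem theorem3p1:
  fixes M :: "('s, 'a) kripke_structure"
    and enc :: "'s \<Rightarrow> 'v \<Rightarrow> bool"
    and E :: "('v, 'a) symbolic"
    and \<psi> :: "'a ltl"
  assumes "kripke M"
    and "represents enc E M"
  shows "((\<exists>\<pi>. initialised_path M \<pi> \<and> ltl_sat M \<pi> \<psi>) \<longleftrightarrow> (\<exists>k. satisfiable (encoding E \<psi> k))) \<and>
         (\<forall>k \<pi>. initialised_path M \<pi> \<and> bounded_sat M k \<pi> \<psi> \<longrightarrow> satisfiable (encoding E \<psi> k))"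
  using satisfiable_encoding_if_ltl_sat[OF assms] ltl_sat_if_satisfiable_encoding[OF assms]
    satisfiable_encoding_if_kl_loop[OF assms] satisfiable_encoding_if_ltl_nl_at[OF assms]
  unfolding ltl_sat_def bounded_sat_def by blast

end
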